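(* Let $n\ge 3$ and let $\mathbf{u}$ and $\mathbf{v}$ be two (possibly empty) $\mathbf{x}\mathbf{y}$-words such that $|\mathbf{u}|+|\mathbf{v}|=n-3$. Then the difference $$F_{\mathbf{u}\mathbf{y}\mathbf{x}\mathbf{v}}(t)-F_{\mathbf{u}\mathbf{y}\mathbf{y}\overline{\mathbf{v}}}(t)$$ has positive coefficients at $1,t,\dots,t^{n-1}$. That is, for $0\le i\le n-1$, the descent polytope $\mathrm{DP}_{\mathbf{u}\mathbf{y}\mathbf{x}\mathbf{v}}$ has (strictly) more faces of dimension $i$ than the descent polytope $\mathrm{DP}_{\mathbf{u}\mathbf{y}\mathbf{y}\overline{\mathbf{v}}}$.
   Context: An $\mathbf{x}\mathbf{y}$-word is a finite (possibly empty) word in the two letters $\mathbf{x},\mathbf{y}$; $|\mathbf{v}|$ denotes the length of $\mathbf{v}$, juxtaposition denotes concatenation, and $\overline{\mathbf{v}}$ denotes the word obtained from $\mathbf{v}$ by replacing every $\mathbf{x}$ by $\mathbf{y}$ and every $\mathbf{y}$ by $\mathbf{x}$. Descent polytope: for an $\mathbf{x}\mathbf{y}$-word $\mathbf{w}=\mathbf{w}_1\cdots\mathbf{w}_{n-1}$ of length $n-1$ ($n\ge 1$), $\mathrm{DP}_{\mathbf{w}}\subset\mathbb{R}^n$ is the set of points $(x_1,\dots,x_n)$ with $0\le x_i\le 1$ for all $i$, and, for $1\le i\le n-1$, $x_i\le x_{i+1}$ if $\mathbf{w}_i=\mathbf{x}$ and $x_i\ge x_{i+1}$ if $\mathbf{w}_i=\mathbf{y}$.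 $f$-polynomial: $F_{\mathbf{w}}(t)=\sum_{\mathcal F} t^{\dim\mathcal F}$, the sum being over all nonempty faces $\mathcal F$ of $\mathrm{DP}_{\mathbf{w}}$, including $\mathrm{DP}_{\mathbf{w}}$ itself. *)

theory Defs
  imports "HOL-Analysis.Analysis" "HOL-Computational_Algebra.Polynomial"
begin

datatype letter = Lx | Ly

primrec swap_letter :: "letter \<Rightarrow> letter" where
  "swap_letter Lx = Ly"
| "swap_letter Ly = Lx"

definition bar :: "letter list \<Rightarrow> letter list" where
  "bar w = map swap_letter w"

text \<open>The coordinates of \<open>real ^ 'n\<close> are numbered along the linear order of the index type,
  starting from \<open>0\<close>: the mathematical \<open>x\<^sub>1, \<dots>, x\<^sub>n\<close> are
  \<open>coord x 0, \<dots>, coord x (n - 1)\<close>, where \<open>n = CARD('n)\<close>.\<close>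

definition coord :: "real ^ 'n::{finite,linorder} \<Rightarrow> nat \<Rightarrow> real" where
  "coord x i = x $ (sorted_list_of_set UNIV ! i)"

text \<open>Meant for words with \<open>length w + 1 = CARD('n)\<close>, since \<open>coord\<close> is unspecified at
  positions outside \<open>{..<CARD('n)}\<close>.\<close>

definition descent_polytope :: "letter list \<Rightarrow> (real ^ 'n::{finite,linorder}) set" where
  "descent_polytope w =
     {x. (\<forall>i < CARD('n). 0 \<le> coord x i \<and> coord x i \<le> 1) \<and>
         (\<forall>i < length w. (w ! i = Lx \<longrightarrow> coord x i \<le> coord x (Suc i)) \<and>
                         (w ! i = Ly \<longrightarrow> coord x i \<ge> coord x (Suc i)))}"

text \<open>Meant for polytopes, which have finitely many faces. A nonempty face has
  \<open>aff_dim \<ge> 0\<close>, so \<open>nat\<close> loses nothing.\<close>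

definition f_polynomial :: "'a::euclidean_space set \<Rightarrow> int poly" where
  "f_polynomial P = (\<Sum>F | F face_of P \<and> F \<noteq> {}. monom 1 (nat (aff_dim F)))"

lemma coord_cover:
  fixes k :: "'n::{finite,linorder}"
  obtains i where "i < CARD('n)" "\<And>x. x $ k = coord x i"
proof -
  have "k \<in> set (sorted_list_of_set UNIV)" by simp
  then obtain i where "i < length (sorted_list_of_set (UNIV :: 'n set))"
    "sorted_list_of_set UNIV ! i = k"
    by (metis in_set_conv_nth)
  then show thesis by (intro that[of i]) (auto simp: coord_def)
qed

lemma coord_eq_inner: "coord x i = axis (sorted_list_of_set UNIV ! i) 1 \<bullet> x"
  by (simp add: coord_def inner_axis')

lemma polyhedron_coord_le_coord:
  "polyhedron {x :: (real, 'n::{finite,linorder}) vec. coord x i \<le> coord x j}"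
proof -
  have "{x :: (real, 'n) vec. coord x i \<le> coord x j} = {x. (axis (sorted_list_of_set UNIV ! i) 1
      - axis (sorted_list_of_set UNIV ! j) 1) \<bullet> x \<le> 0}"
    by (simp add: coord_eq_inner inner_diff_left)
  then show ?thesis by (simp only: polyhedron_halfspace_le)
qed

lemma polytope_descent_polytope:
  "polytope (descent_polytope w :: ((real, 'n::{finite,linorder}) vec) set)"
proof -
  have eq: "(descent_polytope w :: ((real, 'n) vec) set) =
      cbox 0 1 \<inter> (\<Inter>i<length w. if w ! i = Lx then {x. coord x i \<le> coord x (Suc i)}
                                  else {x. coord x (Suc i) \<le> coord x i})" (is "_ = _ \<inter> ?B")
  proof -
    have "(\<forall>i < CARD('n). 0 \<le> coord x i \<and> coord x i \<le> 1) \<longleftrightarrow> x \<in> cbox 0 1"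
      for x :: "(real, 'n) vec"
    proof
      assume *: "\<forall>i < CARD('n). 0 \<le> coord x i \<and> coord x i \<le> 1"
      have "0 \<le> x $ k \<and> x $ k \<le> 1" for k
        by (rule coord_cover[of k]) (use * in auto)
      then show "x \<in> cbox 0 1" by (auto simp: mem_box_cart)
    qed (auto simp: mem_box_cart coord_def)
    moreover have "(\<forall>i < length w. (w ! i = Lx \<longrightarrow> coord x i \<le> coord x (Suc i)) \<and>
        (w ! i = Ly \<longrightarrow> coord x i \<ge> coord x (Suc i))) \<longleftrightarrow> x \<in> ?B" for x :: "(real, 'n) vec"
      by (auto split: if_splits) (metis letter.exhaust)+
    ultimately show ?thesis unfolding descent_polytope_def by blast
  qed
  have "polyhedron ?B"
    by (intro polyhedron_Inter) (auto simp: polyhedron_coord_le_coord)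
  then have "polyhedron (descent_polytope w :: ((real, 'n) vec) set)"
    unfolding eq by (rule polyhedron_Int[OF polytope_imp_polyhedron[OF polytope_interval]])
  moreover have "bounded (descent_polytope w :: ((real, 'n) vec) set)"
    unfolding eq by (rule bounded_subset[OF bounded_cbox]) blast
  ultimately show ?thesis by (simp add: polytope_eq_bounded_polyhedron)
qed

lemma coeff_f_polynomial:
  assumes "polytope P"
  shows "coeff (f_polynomial P) i = int (card {F. F face_of P \<and> aff_dim F = int i})"
proof -
  have fin: "finite {F. F face_of P \<and> F \<noteq> {}}"
    using finite_polytope_faces[OF assms] by (rule rev_finite_subset) blast
  have "{F. F face_of P \<and> aff_dim F = int i} =
      {F. F face_of P \<and> F \<noteq> {}} \<inter> {F. nat (aff_dim F) = i}"
    by (auto simp del: aff_dim_negative_iff simp flip: aff_dim_negative_iff)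
  then show ?thesis
    using fin by (simp add: f_polynomial_def coeff_sum sum.If_cases Int_def)
qed

end

theory Submission
  imports Defs
begin

text \<open>
A nonempty face of a polytope is determined by the constraints that are tight at any of its
relative interior points. For a descent polytope these are read off by walking along the
coordinates: record for each coordinate whether it is \<open>0\<close>, is \<open>1\<close>, lies strictly between
and repeats its predecessor, or lies strictly between and is new. Nonempty faces thus correspond
to such codes, and the dimension of a face is the number of new free values
(\<open>aff_dim_tight_space\<close>). Which code may follow which depends only on the letter between
the two positions, and every locally admissible code is realised by a point, since there is always
room for a new value in the open unit interval above or below the preceding value. Hence the
\<open>f\<close>-polynomial is computed by a product of transfer matrices, one for each letter
(\<open>f_polynomial_descent_polytope\<close>, \<open>completion_poly_simps\<close>).

Reflecting \<open>[0, 1]\<close> turns a word into its bar and exchanges the states \<open>0\<close> and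
\<open>1\<close>, so the \<open>f\<close>-polynomials of \<open>u y x v\<close> and of \<open>u y y (bar v)\<close>
start with the same vector of weights after \<open>u y\<close> and then apply the same row of weights,
once as it is and once with the entries for \<open>0\<close> and \<open>1\<close> exchanged. Therefore the
difference is the product of the difference of the \<open>0\<close>- and \<open>1\<close>-entries of the
vector with that of the row. By
the recursion the first factor is a sum of weights of \<open>u\<close> and the second is a sum of weights
of \<open>v\<close>, so nothing negative is left. Each factor has only positive coefficients up to
degree \<open>|u| + 1\<close> and \<open>|v| + 1\<close>, because a free state can be prolonged by one letter
either without or with a new value, that is, with weight \<open>1 + t\<close>. The degrees add up to
\<open>n - 1\<close>.
\<close>

section \<open>Faces of a polyhedron from tight constraints\<close>

text \<open>A pair \<open>(a, b)\<close> in \<open>J\<close> stands for the inequality \<open>a \<bullet> y \<le> b\<close>.\<close>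
definition tight_space :: "('a::euclidean_space \<times> real) set \<Rightarrow> 'a \<Rightarrow> 'a set" where
  "tight_space J x = {y. \<forall>(a, b) \<in> J. a \<bullet> x = b \<longrightarrow> a \<bullet> y = b}"

lemma affine_tight_space: "affine (tight_space J x)"
proof -
  have "tight_space J x = (\<Inter>(a, b) \<in> {(a, b) \<in> J. a \<bullet> x = b}. {y. a \<bullet> y = b})"
    by (auto simp: tight_space_def)
  also have "affine \<dots>"
    by (intro affine_Inter) (auto simp: affine_hyperplane)
  finally show ?thesis .
qed

text \<open>Near \<open>x\<close> the constraints that are slack at \<open>x\<close> stay slack. So the face cut out by
  the tight ones contains a neighbourhood of \<open>x\<close> in the affine space they define; this puts
  \<open>x\<close> in the relative interior and gives the dimension.\<close>
lemma tight_face: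
  fixes J :: "('a::euclidean_space \<times> real) set"
  assumes J: "finite J" and P: "P = {y. \<forall>(a, b) \<in> J. a \<bullet> y \<le> b}" and x: "x \<in> P"
  shows "(P \<inter> tight_space J x) face_of P"
    and "x \<in> rel_interior (P \<inter> tight_space J x)"
    and "aff_dim (P \<inter> tight_space J x) = aff_dim (tight_space J x)"
proof -
  define H where "H = tight_space J x"
  \<comment> \<open>The neighbourhood on which the slack constraints stay slack.\<close>
  define T where "T = (\<Inter>(a, b) \<in> {(a, b) \<in> J. a \<bullet> x < b}. {y. a \<bullet> y < b})"
  have "P = (\<Inter>(a, b) \<in> J. {y. a \<bullet> y \<le> b})"
    unfolding P by auto
  also have "convex \<dots>"
    by (intro convex_INT) (auto simp: convex_halfspace_le)
  finally have convP: "convex P" .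
  have le: "a \<bullet> y \<le> b" if "(a, b) \<in> J" "y \<in> P" for a b y
    using that P by auto
  have "P \<inter> H = \<Inter> (insert P ((\<lambda>(a, b). P \<inter> {y. a \<bullet> y = b}) ` {(a, b) \<in> J. a \<bullet> x = b}))"
    by (auto simp: H_def tight_space_def)
  also have "\<dots> face_of P"
    by (rule face_of_Inter)
      (use le in \<open>auto intro!: face_of_refl face_of_Int_supporting_hyperplane_le convP\<close>)
  finally show "(P \<inter> tight_space J x) face_of P" by (simp add: H_def)
  have "open T" unfolding T_def
    by (rule open_INT) (use J in \<open>auto intro: finite_subset simp: open_halfspace_lt\<close>)
  have xT: "x \<in> T" by (auto simp: T_def)
  have TP: "T \<inter> H \<subseteq> P"
    using x by (fastforce simp: T_def H_def P tight_space_def order_le_less)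
  have xH: "x \<in> H" by (auto simp: H_def tight_space_def)
  have affH: "affine H" by (simp add: H_def affine_tight_space)
  have "affine hull (P \<inter> H) \<subseteq> H"
    using affH by (simp add: hull_minimal)
  then have "T \<inter> affine hull (P \<inter> H) \<subseteq> P \<inter> H" using TP by blast
  then show "x \<in> rel_interior (P \<inter> tight_space J x)"
    unfolding mem_rel_interior H_def[symmetric] using \<open>open T\<close> xT xH x by blast
  have "openin (top_of_set H) (T \<inter> H)"
    using \<open>open T\<close> by (simp add: Int_commute openin_open_Int)
  then have "aff_dim (T \<inter> H) = aff_dim H"
    using aff_dim_openin affH xT xH by blast
  moreover have "aff_dim (T \<inter> H) \<le> aff_dim (P \<inter> H)" "aff_dim (P \<inter> H) \<le> aff_dim H"
    using TP by (auto intro!: aff_dim_subset)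
  ultimately show "aff_dim (P \<inter> tight_space J x) = aff_dim (tight_space J x)"
    by (simp add: H_def)
qed

text \<open>Faces with a common relative interior point coincide, so a face equals the tight face of any
  of its relative interior points.\<close>
lemma nonempty_faces_eq_tight_faces:
  fixes J :: "('a::euclidean_space \<times> real) set"
  assumes "finite J" and "P = {y. \<forall>(a, b) \<in> J. a \<bullet> y \<le> b}"
  shows "{F. F face_of P \<and> F \<noteq> {}} = (\<lambda>x. P \<inter> tight_space J x) ` P"
proof (intro equalityI subsetI)
  fix F assume "F \<in> {F. F face_of P \<and> F \<noteq> {}}"
  then have F: "F face_of P" "F \<noteq> {}" by auto
  then obtain x where x: "x \<in> rel_interior F"
    using rel_interior_eq_empty face_of_imp_convex by blast
  then have "x \<in> P" using F face_of_imp_subset rel_interior_subset by blast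
  then show "F \<in> (\<lambda>x. P \<inter> tight_space J x) ` P"
    using face_of_eq[OF F(1) tight_face(1)[OF assms]] tight_face(2)[OF assms] x by blast
next
  fix F assume "F \<in> (\<lambda>x. P \<inter> tight_space J x) ` P"
  then obtain x where "x \<in> P" "F = P \<inter> tight_space J x" by blast
  then show "F \<in> {F. F face_of P \<and> F \<noteq> {}}"
    using tight_face(1)[OF assms] by (auto simp: tight_space_def)
qed

section \<open>Codes of faces\<close>

text \<open>\<open>At0\<close> and \<open>At1\<close> mark coordinates on the boundary of the unit interval;
  \<open>Same\<close> and \<open>New\<close> mark coordinates strictly inside it, so that two adjacent zeros are
  coded \<open>At0, At0\<close> and each block of equal coordinates inside the interval contributes
  exactly one \<open>New\<close>.\<close>
datatype code = At0 | At1 | Same | New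

definition code_at :: "(nat \<Rightarrow> real) \<Rightarrow> nat \<Rightarrow> code" where
  "code_at f i = (if f i = 0 then At0 else if f i = 1 then At1
     else if i > 0 \<and> f (i - 1) = f i then Same else New)"

text \<open>The transitions possible across one letter. Across \<open>x\<close> the value may not fall: it can
  leave \<open>0\<close> freely, cannot leave \<open>1\<close>, and cannot reach \<open>0\<close> from inside the
  interval; \<open>y\<close> is the mirror image. From the boundary, \<open>Same\<close> is impossible.\<close>
fun follows :: "letter \<Rightarrow> code \<Rightarrow> code \<Rightarrow> bool" where
  "follows Lx At0 c \<longleftrightarrow> c \<noteq> Same"
| "follows Lx At1 c \<longleftrightarrow> c = At1"
| "follows Lx Same c \<longleftrightarrow> c \<noteq> At0"
| "follows Lx New c \<longleftrightarrow> c \<noteq> At0"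
| "follows Ly At1 c \<longleftrightarrow> c \<noteq> Same"
| "follows Ly At0 c \<longleftrightarrow> c = At0"
| "follows Ly Same c \<longleftrightarrow> c \<noteq> At1"
| "follows Ly New c \<longleftrightarrow> c \<noteq> At1"

fun completions :: "letter list \<Rightarrow> code \<Rightarrow> code list set" where
  "completions [] c = {[]}"
| "completions (l # w) c = (\<Union>d \<in> {d. follows l c d}. (#) d ` completions w d)"

text \<open>The first coordinate has no predecessor, hence cannot be \<open>Same\<close>.\<close>
definition codes :: "letter list \<Rightarrow> code list set" where
  "codes w = (\<Union>d \<in> {At0, At1, New}. (#) d ` completions w d)"

lemma completions_iff:
  "cs \<in> completions w c \<longleftrightarrow>
     length cs = length w \<and> (\<forall>i < length w. follows (w ! i) ((c # cs) ! i) (cs ! i))"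
proof (induction w arbitrary: c cs)
  case (Cons l w)
  show ?case
    by (cases cs) (auto simp: Cons.IH All_less_Suc2)
qed auto

lemma codes_iff:
  "cs \<in> codes w \<longleftrightarrow> length cs = Suc (length w) \<and> cs ! 0 \<noteq> Same \<and>
     (\<forall>i < length w. follows (w ! i) (cs ! i) (cs ! Suc i))"
proof (cases cs)
  case (Cons c ds)
  have "c \<in> {At0, At1, New} \<longleftrightarrow> c \<noteq> Same" by (cases c) auto
  then show ?thesis by (auto simp: Cons codes_def completions_iff)
qed (auto simp: codes_def)

text \<open>The descent polytope in terms of functions on positions, which can be built by
  recursion along the word, unlike vectors over a fixed index type.\<close>

definition descent_seq :: "letter list \<Rightarrow> (nat \<Rightarrow> real) \<Rightarrow> bool" where
  "descent_seq w f \<longleftrightarrow> (\<forall>i \<le> length w. 0 \<le> f i \<and> f i \<le> 1) \<and>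
     (\<forall>i < length w. (w ! i = Lx \<longrightarrow> f i \<le> f (Suc i)) \<and> (w ! i = Ly \<longrightarrow> f (Suc i) \<le> f i))"

lemma code_of_descent_seq:
  assumes "descent_seq w f"
  shows "map (code_at f) [0..<Suc (length w)] \<in> codes w"
proof -
  have "follows (w ! i) (code_at f i) (code_at f (Suc i))" if "i < length w" for i
  proof -
    have "0 \<le> f i \<and> f i \<le> 1" "0 \<le> f (Suc i) \<and> f (Suc i) \<le> 1"
      "w ! i = Lx \<Longrightarrow> f i \<le> f (Suc i)" "w ! i = Ly \<Longrightarrow> f (Suc i) \<le> f i"
      using assms that by (simp_all add: descent_seq_def)
    then show ?thesis
      by (cases "w ! i"; cases "code_at f i") (auto simp: code_at_def split: if_splits)
  qed
  then show ?thesis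
    unfolding codes_iff by (auto simp: code_at_def simp del: upt_Suc)
qed

text \<open>A point with prescribed code. After \<open>x\<close> a new value is placed halfway to \<open>1\<close>,
  after \<open>y\<close> halfway to \<open>0\<close>, which keeps it strictly inside the interval and different
  from its predecessor even if that predecessor is the opposite endpoint.\<close>
primrec decode :: "letter list \<Rightarrow> code list \<Rightarrow> nat \<Rightarrow> real" where
  "decode w cs 0 = (case cs ! 0 of At0 \<Rightarrow> 0 | At1 \<Rightarrow> 1 | _ \<Rightarrow> 1 / 2)"
| "decode w cs (Suc i) = (case cs ! Suc i of At0 \<Rightarrow> 0 | At1 \<Rightarrow> 1 | Same \<Rightarrow> decode w cs i
     | New \<Rightarrow> if w ! i = Lx then (decode w cs i + 1) / 2 else decode w cs i / 2)"

lemma decode: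
  assumes "cs \<in> codes w"
  shows "descent_seq w (decode w cs)" and "map (code_at (decode w cs)) [0..<Suc (length w)] = cs"
proof -
  let ?f = "decode w cs"
  have first: "cs ! 0 \<noteq> Same" and len: "length cs = Suc (length w)"
    and step: "\<And>i. i < length w \<Longrightarrow> follows (w ! i) (cs ! i) (cs ! Suc i)"
    using assms by (auto simp: codes_iff)
  have val: "(cs ! i = At0 \<longrightarrow> ?f i = 0) \<and> (cs ! i = At1 \<longrightarrow> ?f i = 1) \<and>
      (cs ! i = Same \<or> cs ! i = New \<longrightarrow> 0 < ?f i \<and> ?f i < 1)" if "i \<le> length w" for i
    using that
  proof (induction i)
    case 0
    then show ?case using first by (cases "cs ! 0") auto
  next
    case (Suc i)
    then show ?case using step[of i]
      by (cases "cs ! i"; cases "cs ! Suc i"; cases "w ! i") auto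
  qed
  have bounds: "0 \<le> ?f i \<and> ?f i \<le> 1" if "i \<le> length w" for i
    using val[OF that] by (cases "cs ! i") auto
  have order: "(w ! i = Lx \<longrightarrow> ?f i \<le> ?f (Suc i)) \<and> (w ! i = Ly \<longrightarrow> ?f (Suc i) \<le> ?f i)"
    and code: "code_at ?f (Suc i) = cs ! Suc i" if "i < length w" for i
    using step[OF that] val[of i] val[of "Suc i"] that
    by (cases "cs ! i"; cases "cs ! Suc i"; cases "w ! i"; simp add: code_at_def)+
  show "descent_seq w ?f"
    using bounds order by (auto simp: descent_seq_def)
  have "code_at ?f i = cs ! i" if "i \<le> length w" for i
  proof (cases i)
    case 0
    then show ?thesis using first by (cases "cs ! 0") (auto simp: code_at_def)
  qed (use code that in auto)
  then show "map (code_at ?f) [0..<Suc (length w)] = cs"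
    by (intro nth_equalityI) (auto simp: len simp del: upt_Suc)
qed


section \<open>Faces of the descent polytope\<close>

definition constraints :: "letter list \<Rightarrow> ((real ^ 'n::{finite,linorder}) \<times> real) set" where
  "constraints w =
     (let e = (\<lambda>i. axis (sorted_list_of_set UNIV ! i) 1) in
       (\<Union>i<CARD('n). {(- e i, 0), (e i, 1)}) \<union>
       (\<Union>i<length w. {(if w ! i = Lx then e i - e (Suc i) else e (Suc i) - e i, 0)}))"

lemma constraints_iff:
  fixes Q :: "real ^ 'n::{finite,linorder} \<Rightarrow> real \<Rightarrow> bool"
  shows "(\<forall>(a, b) \<in> constraints w. Q a b) \<longleftrightarrow>
    (let e = (\<lambda>i. axis (sorted_list_of_set UNIV ! i) 1) in
      (\<forall>i < CARD('n). Q (- e i) 0 \<and> Q (e i) 1) \<and>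
      (\<forall>i < length w. Q (if w ! i = Lx then e i - e (Suc i) else e (Suc i) - e i) 0))"
  unfolding constraints_def Let_def by blast

lemma finite_constraints: "finite (constraints w)"
  by (simp add: constraints_def Let_def)

lemma descent_polytope_constraints:
  "descent_polytope w = {y. \<forall>(a, b) \<in> constraints w. a \<bullet> y \<le> b}"
proof -
  have "w ! i = Ly \<longleftrightarrow> w ! i \<noteq> Lx" for i by (cases "w ! i") auto
  then show ?thesis
    unfolding descent_polytope_def constraints_iff Let_def
    by (auto simp: coord_eq_inner inner_diff_left)
qed

lemma tight_space_constraints:
  "tight_space (constraints w) (x :: real ^ 'n::{finite,linorder}) =
     {y. (\<forall>i < CARD('n). (coord x i = 0 \<longrightarrow> coord y i = 0) \<and> (coord x i = 1 \<longrightarrow> coord y i = 1)) \<and>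
         (\<forall>i < length w. coord x i = coord x (Suc i) \<longrightarrow> coord y i = coord y (Suc i))}"
  unfolding tight_space_def constraints_iff Let_def
  by (auto simp: coord_eq_inner inner_diff_left)

text \<open>The code determines all tight constraints.\<close>
lemma code_at_iff:
  shows "f i = 0 \<longleftrightarrow> code_at f i = At0"
    and "f i = 1 \<longleftrightarrow> code_at f i = At1"
    and "f i = f (Suc i) \<longleftrightarrow> code_at f (Suc i) = Same \<or>
      (code_at f i = code_at f (Suc i) \<and> code_at f i \<in> {At0, At1})"
  by (auto simp: code_at_def)

definition face_code :: "real ^ 'n::{finite,linorder} \<Rightarrow> code list" where
  "face_code x = map (code_at (coord x)) [0..<CARD('n)]"

lemma face_code_eq_iff:
  fixes x y :: "real ^ 'n::{finite,linorder}"
  shows "face_code x = face_code y \<longleftrightarrow> (\<forall>i < CARD('n). code_at (coord x) i = code_at (coord y) i)"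
  by (auto simp: face_code_def)

lemma tight_face_eq_iff_face_code_eq:
  fixes x y :: "real ^ 'n::{finite,linorder}"
  assumes len: "Suc (length w) = CARD('n)"
    and x: "x \<in> descent_polytope w" and y: "y \<in> descent_polytope w"
  shows "descent_polytope w \<inter> tight_space (constraints w) x =
      descent_polytope w \<inter> tight_space (constraints w) y \<longleftrightarrow> face_code x = face_code y"
proof
  assume eq: "descent_polytope w \<inter> tight_space (constraints w) x =
      descent_polytope w \<inter> tight_space (constraints w) y"
  have "x \<in> tight_space (constraints w) x" "y \<in> tight_space (constraints w) y"
    by (auto simp: tight_space_def)
  then have "x \<in> tight_space (constraints w) y" "y \<in> tight_space (constraints w) x"
    using eq x y by auto
  then have *: "\<forall>i < CARD('n). (coord x i = 0 \<longleftrightarrow> coord y i = 0) \<and> (coord x i = 1 \<longleftrightarrow> coord y i = 1)"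
    "\<forall>i < length w. coord x i = coord x (Suc i) \<longleftrightarrow> coord y i = coord y (Suc i)"
    unfolding tight_space_constraints mem_Collect_eq by blast+
  have "code_at (coord x) i = code_at (coord y) i" if i: "i < CARD('n)" for i
  proof -
    have "0 < i \<and> coord x (i - 1) = coord x i \<longleftrightarrow> 0 < i \<and> coord y (i - 1) = coord y i"
      using *(2)[rule_format, of "i - 1"] i len by (cases i) simp_all
    then show ?thesis unfolding code_at_def using *(1) i by presburger
  qed
  then show "face_code x = face_code y"
    by (simp add: face_code_eq_iff)
next
  assume "face_code x = face_code y"
  then have same: "code_at (coord x) i = code_at (coord y) i" if "i < CARD('n)" for i
    using that by (simp add: face_code_eq_iff)
  have "coord x i = 0 \<longleftrightarrow> coord y i = 0" "coord x i = 1 \<longleftrightarrow> coord y i = 1" if "i < CARD('n)" for i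
    using same[OF that] unfolding code_at_iff(1,2)[of "coord _"] by simp_all
  moreover have "coord x i = coord x (Suc i) \<longleftrightarrow> coord y i = coord y (Suc i)" if "i < length w" for i
    using same[of i] same[of "Suc i"] that len unfolding code_at_iff(3)[of "coord _"] by simp
  ultimately have "tight_space (constraints w) x = tight_space (constraints w) y"
    unfolding tight_space_constraints using len by simp
  then show "descent_polytope w \<inter> tight_space (constraints w) x =
      descent_polytope w \<inter> tight_space (constraints w) y" by simp
qed

lemma bij_betw_index:
  "bij_betw ((!) (sorted_list_of_set UNIV)) {..<CARD('n)} (UNIV :: 'n::{finite,linorder} set)"
  by (rule bij_betw_nth) auto

definition vec_of_seq :: "(nat \<Rightarrow> real) \<Rightarrow> real ^ 'n::{finite,linorder}" where
  "vec_of_seq f = (\<chi> k. f (inv_into {..<CARD('n)} ((!) (sorted_list_of_set UNIV)) k))"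

lemma coord_vec_of_seq:
  "i < CARD('n) \<Longrightarrow> coord (vec_of_seq f :: real ^ 'n::{finite,linorder}) i = f i"
  using bij_betw_inv_into_left[OF bij_betw_index[where 'n = 'n], of i]
  by (simp add: coord_def vec_of_seq_def)

lemma vec_eq_iff_coord:
  fixes x y :: "real ^ 'n::{finite,linorder}"
  shows "x = y \<longleftrightarrow> (\<forall>i < CARD('n). coord x i = coord y i)"
  by (metis coord_cover vec_eq_iff)

lemma descent_polytope_iff_descent_seq:
  fixes x :: "real ^ 'n::{finite,linorder}"
  assumes "Suc (length w) = CARD('n)"
  shows "x \<in> descent_polytope w \<longleftrightarrow> descent_seq w (coord x)"
  unfolding descent_polytope_def descent_seq_def using assms[symmetric]
  by (auto simp: less_Suc_eq_le)

text \<open>No global obstruction occurs: local admissibility of the transitions suffices.\<close>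
lemma face_code_image:
  assumes len: "Suc (length w) = CARD('n::{finite,linorder})"
  shows "face_code ` (descent_polytope w :: (real ^ 'n::{finite,linorder}) set) = codes w"
proof (intro equalityI subsetI)
  fix cs assume "cs \<in> face_code ` (descent_polytope w :: (real ^ 'n::{finite,linorder}) set)"
  then show "cs \<in> codes w"
    using code_of_descent_seq[of w] len
    by (auto simp: descent_polytope_iff_descent_seq face_code_def)
next
  fix cs assume cs: "cs \<in> codes w"
  define x :: "(real, 'n) vec" where "x = vec_of_seq (decode w cs)"
  have x: "coord x i = decode w cs i" if "i < CARD('n)" for i
    using that by (simp add: x_def coord_vec_of_seq)
  have "x \<in> descent_polytope w"
    using decode(1)[OF cs] len
    by (auto simp: descent_polytope_iff_descent_seq descent_seq_def x)
  moreover have "face_code x = cs"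
  proof -
    have "code_at (coord x) i = code_at (decode w cs) i" if "i < CARD('n)" for i
      using that by (auto simp: code_at_def x)
    then have "face_code x = map (code_at (decode w cs)) [0..<CARD('n)]"
      by (simp add: face_code_def)
    then show ?thesis using decode(2)[OF cs] len by simp
  qed
  ultimately show "cs \<in> face_code ` (descent_polytope w :: (real, 'n) vec set)" by blast
qed

text \<open>The first position of the block of equal values that contains \<open>i\<close>.\<close>
primrec leader :: "(nat \<Rightarrow> real) \<Rightarrow> nat \<Rightarrow> nat" where
  "leader f 0 = 0"
| "leader f (Suc i) = (if f i = f (Suc i) then leader f i else Suc i)"

lemma leader_le: "leader f i \<le> i"
  by (induction i) auto

lemma leader_value: "f (leader f i) = f i"
  by (induction i) auto

lemma code_at_leader:
  "f i \<noteq> 0 \<Longrightarrow> f i \<noteq> 1 \<Longrightarrow> code_at f (leader f i) = New"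
proof (induction i)
  case (Suc i)
  show ?case
  proof (cases "f i = f (Suc i)")
    case True
    then show ?thesis using Suc by simp
  next
    case False
    then show ?thesis using Suc.prems by (simp add: code_at_def)
  qed
qed (simp add: code_at_def)

lemma leader_New: "code_at f i = New \<Longrightarrow> leader f i = i"
  by (cases i) (auto simp: code_at_def split: if_splits)

text \<open>A direction along the face vanishes on the blocks at \<open>0\<close> and \<open>1\<close> and is constant on
  each other block, so it is given by its values at the leaders of those blocks, which can be
  chosen freely. These leaders are the positions with code \<open>New\<close>.\<close>
lemma aff_dim_tight_space:
  fixes x :: "real ^ 'n::{finite,linorder}"
  assumes len: "Suc (length w) = CARD('n)"
  shows "aff_dim (tight_space (constraints w) x) = int (count_list (face_code x) New)"
proof -
  let ?f = "coord x"
  define L where "L = {i. i < CARD('n) \<and> code_at ?f i = New}"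
  define D where "D = {d :: (real, 'n) vec. \<forall>i < CARD('n). i \<notin> L \<longrightarrow> coord d i = 0}"
  \<comment> \<open>Spreads the value at each leader over its block.\<close>
  define \<phi> :: "(real, 'n) vec \<Rightarrow> (real, 'n) vec" where
    "\<phi> d = vec_of_seq (\<lambda>i. if ?f i = 0 \<or> ?f i = 1 then 0 else coord d (leader ?f i))" for d
  define H where "H = (\<lambda>y. y - x) ` tight_space (constraints w) x"
  have coord_diff: "coord (y - z) i = coord y i - coord z i"
    and coord_add: "coord (y + z) i = coord y i + coord z i"
    and coord_scaleR: "coord (a *\<^sub>R y) i = a * coord y i"
    for y z :: "(real, 'n) vec" and a i by (simp_all add: coord_def)
  have H: "H = {d. (\<forall>i < CARD('n). ?f i = 0 \<or> ?f i = 1 \<longrightarrow> coord d i = 0) \<and>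
      (\<forall>i < length w. ?f i = ?f (Suc i) \<longrightarrow> coord d i = coord d (Suc i))}" (is "_ = ?H")
  proof (intro equalityI subsetI)
    fix d assume "d \<in> H"
    then show "d \<in> ?H"
      by (auto simp: H_def tight_space_constraints coord_diff)
  next
    fix d assume "d \<in> ?H"
    then have "d + x \<in> tight_space (constraints w) x"
      by (auto simp: tight_space_constraints coord_add)
    then show "d \<in> H" unfolding H_def by (intro image_eqI[of _ _ "d + x"]) auto
  qed
  have \<phi>: "coord (\<phi> d) i = (if ?f i = 0 \<or> ?f i = 1 then 0 else coord d (leader ?f i))"
    if "i < CARD('n)" for d i
    using that by (simp add: \<phi>_def coord_vec_of_seq)
  have lin: "linear \<phi>"
    by (rule linearI) (simp_all add: vec_eq_iff_coord \<phi> coord_add coord_scaleR)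
  have \<phi>_L: "coord (\<phi> d) i = coord d i" if "i \<in> L" for d i
    using that by (auto simp: L_def \<phi> leader_New) (auto simp: code_at_def)
  have "subspace D"
    by (auto simp: D_def subspace_def coord_def)
  then have "span D = D" by (simp add: span_eq_iff)
  moreover have "inj_on \<phi> D"
  proof (rule inj_onI)
    fix d e assume de: "d \<in> D" "e \<in> D" and eq: "\<phi> d = \<phi> e"
    have "coord d i = coord e i" if "i < CARD('n)" for i
    proof (cases "i \<in> L")
      case True
      then show ?thesis using \<phi>_L[of i d] \<phi>_L[of i e] eq by simp
    qed (use de that in \<open>simp add: D_def\<close>)
    then show "d = e" by (simp add: vec_eq_iff_coord)
  qed
  ultimately have "dim (\<phi> ` D) = dim D"
    by (metis dim_image_eq lin)
  moreover have "\<phi> ` D = H"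
  proof (intro equalityI subsetI)
    fix d assume "d \<in> \<phi> ` D"
    then show "d \<in> H"
      unfolding H using len by (auto simp: \<phi>)
  next
    fix d assume d: "d \<in> H"
    have lead: "coord d (leader ?f i) = coord d i" if "i < CARD('n)" for i
      using that d len by (induction i) (auto simp: H)
    define r :: "(real, 'n) vec" where "r = vec_of_seq (\<lambda>i. if i \<in> L then coord d i else 0)"
    have r: "coord r i = (if i \<in> L then coord d i else 0)" if "i < CARD('n)" for i
      using that by (simp add: r_def coord_vec_of_seq)
    have "r \<in> D" by (auto simp: D_def r)
    moreover have "\<phi> r = d"
      unfolding vec_eq_iff_coord
    proof (intro allI impI)
      fix i assume i: "i < CARD('n)"
      then have "leader ?f i < CARD('n)" using leader_le le_less_trans by blast
      then show "coord (\<phi> r) i = coord d i"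
        using i d lead[OF i] code_at_leader[of ?f i] by (auto simp: \<phi> r L_def H)
    qed
    ultimately show "d \<in> \<phi> ` D" by blast
  qed
  moreover have "dim D = card L"
  proof -
    let ?idx = "(!) (sorted_list_of_set (UNIV :: 'n set))"
    have "D = {d. \<forall>k. k \<notin> ?idx ` L \<longrightarrow> d $ k = 0}" (is "_ = ?D")
    proof (intro equalityI subsetI)
      fix d assume d: "d \<in> D"
      have "d $ k = 0" if k: "k \<notin> ?idx ` L" for k
      proof -
        have "k \<in> ?idx ` {..<CARD('n)}"
          using bij_betw_imp_surj_on[OF bij_betw_index[where 'n = 'n]] by simp
        then obtain i where i: "i < CARD('n)" "k = ?idx i" by blast
        then have "i \<notin> L" using k by blast
        then show ?thesis using d i by (simp add: D_def coord_def)
      qed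
      then show "d \<in> ?D" by simp
    next
      fix d assume "d \<in> ?D"
      moreover have "?idx i \<notin> ?idx ` L" if "i < CARD('n)" "i \<notin> L" for i
        using that bij_betw_imp_inj_on[OF bij_betw_index[where 'n = 'n]]
        by (auto simp: L_def inj_on_def)
      ultimately show "d \<in> D" by (auto simp: D_def coord_def)
    qed
    then have "dim D = card (?idx ` L)"
      using dim_substandard_cart[of "?idx ` L", where 'a = real] by (simp add: dim_vec_eq)
    also have "\<dots> = card L"
      by (rule card_image, rule inj_on_subset[OF bij_betw_imp_inj_on[OF bij_betw_index]])
        (auto simp: L_def)
    finally show ?thesis .
  qed
  moreover have "card L = count_list (face_code x) New"
    by (simp add: count_list_eq_length_filter length_filter_conv_card face_code_def L_def
        eq_commute[of New] cong: conj_cong)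
  moreover have "aff_dim (tight_space (constraints w) x) = int (dim H)"
    unfolding H_def by (rule aff_dim_eq_dim_subtract, rule hull_inc) (simp add: tight_space_def)
  ultimately show ?thesis by simp
qed

definition face_poly :: "letter list \<Rightarrow> int poly" where
  "face_poly w = (\<Sum>cs\<in>codes w. monom 1 (count_list cs New))"

text \<open>The map from points to tight faces and the map from points to codes have the same fibres, so
  their images, the nonempty faces and the admissible codes, are in bijection.\<close>
lemma f_polynomial_descent_polytope:
  assumes len: "Suc (length w) = CARD('n::{finite,linorder})"
  shows "f_polynomial (descent_polytope w :: (real ^ 'n::{finite,linorder}) set) = face_poly w"
proof -
  let ?P = "descent_polytope w :: (real, 'n) vec set"
  let ?G = "\<lambda>x. ?P \<inter> tight_space (constraints w) x"
  define rep where "rep = inv_into ?P face_code"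
  have rep: "rep cs \<in> ?P" "face_code (rep cs) = cs" if "cs \<in> codes w" for cs
    using that unfolding face_code_image[OF len, symmetric] rep_def
    by (auto intro: inv_into_into f_inv_into_f)
  have G: "?G x = ?G y \<longleftrightarrow> face_code x = face_code y" if "x \<in> ?P" "y \<in> ?P" for x y
    using tight_face_eq_iff_face_code_eq[OF len that] .
  have "bij_betw (?G \<circ> rep) (codes w) (?G ` ?P)"
    unfolding bij_betw_def
  proof
    show "inj_on (?G \<circ> rep) (codes w)"
      by (rule inj_onI) (metis G comp_apply rep)
    show "(?G \<circ> rep) ` codes w = ?G ` ?P"
    proof (intro equalityI subsetI)
      fix F assume "F \<in> ?G ` ?P"
      then obtain x where x: "x \<in> ?P" "F = ?G x" by blast
      then have "face_code x \<in> codes w" using face_code_image[OF len] by blast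
      then show "F \<in> (?G \<circ> rep) ` codes w"
        using G[OF x(1) rep(1)] rep(2) x(2) by (metis comp_apply image_eqI)
    qed (use rep in auto)
  qed
  then have "(\<Sum>F\<in>?G ` ?P. monom (1::int) (nat (aff_dim F))) =
      (\<Sum>cs\<in>codes w. monom 1 (nat (aff_dim (?G (rep cs)))))"
    by (simp add: sum.reindex_bij_betw[symmetric])
  also have "\<dots> = face_poly w"
    unfolding face_poly_def
  proof (rule sum.cong)
    fix cs assume cs: "cs \<in> codes w"
    show "monom 1 (nat (aff_dim (?G (rep cs)))) = monom 1 (count_list cs New)"
      using tight_face(3)[OF finite_constraints descent_polytope_constraints rep(1)[OF cs]]
        aff_dim_tight_space[OF len, of "rep cs"] rep(2)[OF cs]
      by simp
  qed simp
  finally show ?thesis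
    unfolding f_polynomial_def
    nonempty_faces_eq_tight_faces[OF finite_constraints descent_polytope_constraints] .
qed

section \<open>Transfer recursion\<close>

definition t :: "int poly" where
  "t = monom 1 1"

text \<open>The row of transfer weights: the entry for a state \<open>c\<close> counts all continuations of
  \<open>c\<close> along \<open>w\<close> by their number of new free values.\<close>
definition completion_poly :: "letter list \<Rightarrow> code \<Rightarrow> int poly" where
  "completion_poly w c = (\<Sum>cs\<in>completions w c. monom 1 (count_list cs New))"

lemma finite_code: "finite (A :: code set)"
proof (rule finite_subset)
  show "A \<subseteq> {At0, At1, Same, New}" using code.exhaust by blast
qed simp

lemma finite_completions: "finite (completions w c)"
  by (induction w arbitrary: c) (auto intro: finite_code)

lemma sum_first_code:
  "(\<Sum>cs\<in>(\<Union>d\<in>A. (#) d ` completions w d). monom 1 (count_list cs New)) =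
     (\<Sum>d\<in>A. (if d = New then t else 1) * completion_poly w d)"
proof -
  have "(\<Sum>cs\<in>(\<Union>d\<in>A. (#) d ` completions w d). monom (1::int) (count_list cs New)) =
      (\<Sum>d\<in>A. \<Sum>cs\<in>(#) d ` completions w d. monom 1 (count_list cs New))"
    by (rule sum.UNION_disjoint) (auto intro: finite_code finite_completions)
  also have "\<dots> = (\<Sum>d\<in>A. \<Sum>cs\<in>completions w d. monom 1 (count_list (d # cs) New))"
    by (simp add: sum.reindex)
  also have "\<dots> = (\<Sum>d\<in>A. (if d = New then t else 1) * completion_poly w d)"
    by (intro sum.cong)
      (auto simp: completion_poly_def sum_distrib_left t_def mult_monom simp flip: monom_Suc)
  finally show ?thesis .
qed

lemma face_poly_eq:
  "face_poly w = completion_poly w At0 + completion_poly w At1 + t * completion_poly w New"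
  unfolding face_poly_def codes_def sum_first_code by simp

lemma completion_poly_Cons:
  "completion_poly (l # w) c =
     (\<Sum>d | follows l c d. (if d = New then t else 1) * completion_poly w d)"
  unfolding completion_poly_def[of "l # w"] completions.simps sum_first_code ..

text \<open>Whether a free value is new or repeated does not restrict what follows, so three states
  suffice.\<close>
lemma completion_poly_Same: "completion_poly w Same = completion_poly w New"
proof (cases w)
  case (Cons l v)
  have "follows l Same = follows l New" by (cases l) (auto simp: fun_eq_iff)
  then show ?thesis by (simp add: Cons completion_poly_Cons)
qed (simp add: completion_poly_def)

lemma completion_poly_simps:
  "completion_poly [] c = 1"
  "completion_poly (Lx # w) At1 = completion_poly w At1"
  "completion_poly (Lx # w) At0 =
     completion_poly w At0 + completion_poly w At1 + t * completion_poly w New"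
  "completion_poly (Lx # w) New = completion_poly w At1 + (1 + t) * completion_poly w New"
  "completion_poly (Ly # w) At0 = completion_poly w At0"
  "completion_poly (Ly # w) At1 =
     completion_poly w At0 + completion_poly w At1 + t * completion_poly w New"
  "completion_poly (Ly # w) New = completion_poly w At0 + (1 + t) * completion_poly w New"
proof -
  have "{d. d \<noteq> Same} = {At0, At1, New}" "{d. d \<noteq> At0} = {At1, Same, New}"
    "{d. d \<noteq> At1} = {At0, Same, New}"
    using code.exhaust by auto
  then show "completion_poly [] c = 1"
    "completion_poly (Lx # w) At1 = completion_poly w At1"
    "completion_poly (Lx # w) At0 =
       completion_poly w At0 + completion_poly w At1 + t * completion_poly w New"
    "completion_poly (Lx # w) New = completion_poly w At1 + (1 + t) * completion_poly w New"
    "completion_poly (Ly # w) At0 = completion_poly w At0"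
    "completion_poly (Ly # w) At1 =
       completion_poly w At0 + completion_poly w At1 + t * completion_poly w New"
    "completion_poly (Ly # w) New = completion_poly w At0 + (1 + t) * completion_poly w New"
    by (simp_all add: completion_poly_Cons completion_poly_Same algebra_simps)
      (simp add: completion_poly_def)
qed

text \<open>The reflection of the unit interval exchanges the endpoints and the two letters.\<close>
lemma completion_poly_bar:
  "completion_poly (bar w) At0 = completion_poly w At1"
  "completion_poly (bar w) At1 = completion_poly w At0"
  "completion_poly (bar w) New = completion_poly w New"
proof -
  have "completion_poly (bar w) At0 = completion_poly w At1 \<and>
    completion_poly (bar w) At1 = completion_poly w At0 \<and>
    completion_poly (bar w) New = completion_poly w New"
  proof (induction w)
    case (Cons l w)
    then show ?case
      by (cases l) (simp_all add: bar_def completion_poly_simps algebra_simps)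
  qed (simp add: bar_def completion_poly_simps)
  then show "completion_poly (bar w) At0 = completion_poly w At1"
    "completion_poly (bar w) At1 = completion_poly w At0"
    "completion_poly (bar w) New = completion_poly w New"
    by simp_all
qed

section \<open>Positivity of the difference\<close>

definition positive_upto :: "nat \<Rightarrow> int poly \<Rightarrow> bool" where
  "positive_upto d p \<longleftrightarrow> (\<forall>i. 0 \<le> coeff p i) \<and> (\<forall>i \<le> d. 0 < coeff p i)"

lemma positive_upto_add:
  assumes "positive_upto d p" and "positive_upto e q"
  shows "positive_upto d (p + q)"
  using assms by (auto simp: positive_upto_def add_pos_nonneg)

text \<open>Shifting \<open>q\<close> by one degree leaves a gap at degree \<open>0\<close>, which \<open>p\<close> fills.\<close>
lemma positive_upto_add_t_mult:
  assumes "positive_upto e p" and "positive_upto d q"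
  shows "positive_upto (Suc d) (p + t * q)"
proof -
  have "coeff (t * q) i = (case i of 0 \<Rightarrow> 0 | Suc j \<Rightarrow> coeff q j)" for i
    by (simp add: t_def monom_Suc coeff_pCons split: nat.split)
  then show ?thesis
    using assms by (auto simp: positive_upto_def add_nonneg_pos split: nat.split)
qed

lemma positive_upto_add_one_plus_t_mult:
  assumes "positive_upto 0 p" and "positive_upto d q"
  shows "positive_upto (Suc d) (p + (1 + t) * q)"
proof -
  have "p + (1 + t) * q = (p + q) + t * q" by (simp add: algebra_simps)
  then show ?thesis
    using positive_upto_add_t_mult[OF positive_upto_add[OF assms] assms(2)] by (simp only:)
qed

lemma positive_upto_mono: "positive_upto d p \<Longrightarrow> e \<le> d \<Longrightarrow> positive_upto e p"
  by (auto simp: positive_upto_def)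

lemma positive_upto_mult:
  assumes "positive_upto d p" and "positive_upto e q"
  shows "positive_upto (d + e) (p * q)"
  unfolding positive_upto_def
proof (intro conjI allI impI)
  have nonneg: "0 \<le> coeff p k * coeff q (i - k)" for i k
    using assms by (simp add: positive_upto_def)
  fix i
  show "0 \<le> coeff (p * q) i"
    unfolding coeff_mult by (intro sum_nonneg nonneg)
  assume "i \<le> d + e"
  \<comment> \<open>One positive summand suffices; taking degree \<open>min i d\<close> from \<open>p\<close> leaves at most \<open>e\<close>.\<close>
  then have "0 < coeff p (min i d) * coeff q (i - min i d)"
    using assms by (auto simp: positive_upto_def)
  then show "0 < coeff (p * q) i"
    unfolding coeff_mult by (intro sum_pos2[where i = "min i d"] nonneg) auto
qed

text \<open>A free state can be prolonged by each letter as \<open>Same\<close> or as \<open>New\<close>; the resulting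
  factor \<open>1 + t\<close> raises the range of positive coefficients by one. The other two entries only
  need a positive constant term.\<close>
lemma positive_upto_completion_poly:
  "positive_upto 0 (completion_poly w At0) \<and> positive_upto 0 (completion_poly w At1) \<and>
     positive_upto (length w) (completion_poly w New)"
proof (induction w)
  case Nil
  show ?case by (simp add: completion_poly_simps positive_upto_def)
next
  case (Cons l w)
  let ?Z = "completion_poly w At0" and ?O = "completion_poly w At1"
    and ?N = "completion_poly w New"
  have sum: "positive_upto 0 (?Z + ?O + t * ?N)"
    using Cons.IH by (blast intro: positive_upto_add positive_upto_add_t_mult positive_upto_mono)
  show ?case
    using Cons.IH sum
    by (cases l) (simp_all add: completion_poly_simps positive_upto_add_one_plus_t_mult)
qed

text \<open>The column of transfer weights of a prefix \<open>u\<close>: \<open>z\<close>, \<open>r\<close> and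
  \<open>t * \<psi>\<close> count the codes of \<open>u\<close> that end at \<open>0\<close>, at \<open>1\<close> and inside the
  interval. A factor \<open>t\<close> splits off from the last because a value inside the interval must
  have been new at some position.\<close>
lemma face_poly_append:
  "\<exists>z r \<psi>. (\<forall>w. face_poly (u @ w) = z * completion_poly w At0 + r * completion_poly w At1
       + t * \<psi> * completion_poly w New)
     \<and> positive_upto 0 z \<and> positive_upto 0 r \<and> positive_upto (length u) \<psi>"
proof (induction u rule: rev_induct)
  case Nil
  show ?case
    by (intro exI[of _ 1]) (simp add: face_poly_eq positive_upto_def)
next
  case (snoc l u)
  then obtain z r \<psi> where
    eq: "\<And>w. face_poly (u @ w) = z * completion_poly w At0 + r * completion_poly w At1
       + t * \<psi> * completion_poly w New"
    and pos: "positive_upto 0 z" "positive_upto 0 r" "positive_upto (length u) \<psi>"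
    by auto
  have sum: "positive_upto 0 (z + r + t * \<psi>)"
    using pos by (metis add.commute positive_upto_add positive_upto_add_t_mult positive_upto_mono zero_le)
  show ?case
  proof (cases l)
    case Lx
    have "face_poly ((u @ [l]) @ w) = z * completion_poly w At0
        + (z + r + t * \<psi>) * completion_poly w At1
        + t * (z + (1 + t) * \<psi>) * completion_poly w New" for w
      using eq[of "l # w"] by (simp add: Lx completion_poly_simps algebra_simps)
    then show ?thesis using pos sum positive_upto_add_one_plus_t_mult by fastforce
  next
    case Ly
    have "face_poly ((u @ [l]) @ w) = (z + r + t * \<psi>) * completion_poly w At0
        + r * completion_poly w At1
        + t * (r + (1 + t) * \<psi>) * completion_poly w New" for w
      using eq[of "l # w"] by (simp add: Ly completion_poly_simps algebra_simps)
    then show ?thesis using pos sum positive_upto_add_one_plus_t_mult by fastforce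
  qed
qed

text \<open>Appending \<open>y\<close> to \<open>u\<close> turns the entries \<open>z, r\<close> into
  \<open>z + r + t * \<psi>, r\<close>, whose difference is \<open>z + t * \<psi>\<close>; prepending \<open>x\<close> to
  \<open>v\<close> likewise gives the second factor. All other terms cancel by the reflection symmetry.\<close>
lemma face_poly_difference_positive:
  "positive_upto (length u + length v + 2)
     (face_poly (u @ [Ly, Lx] @ v) - face_poly (u @ [Ly, Ly] @ bar v))"
proof -
  obtain z r \<psi> where
    eq: "\<And>w. face_poly (u @ w) = z * completion_poly w At0 + r * completion_poly w At1
       + t * \<psi> * completion_poly w New"
    and pos: "positive_upto 0 z" "positive_upto (length u) \<psi>"
    using face_poly_append by blast
  have "face_poly (u @ [Ly, Lx] @ v) - face_poly (u @ [Ly, Ly] @ bar v) =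
      (z + t * \<psi>) * (completion_poly v At0 + t * completion_poly v New)"
    unfolding eq by (simp add: completion_poly_simps completion_poly_bar algebra_simps)
  moreover have "positive_upto (Suc (length u)) (z + t * \<psi>)"
    using pos by (rule positive_upto_add_t_mult)
  moreover have "positive_upto (Suc (length v)) (completion_poly v At0 + t * completion_poly v New)"
    using positive_upto_completion_poly by (blast intro: positive_upto_add_t_mult)
  ultimately show ?thesis
    using positive_upto_mult by fastforce
qed

theorem theorem2p4:
  fixes n :: nat and u v :: "letter list"
    and P Q :: "(real ^ 'n::{finite,linorder}) set"
  assumes "n \<ge> 3" and "CARD('n) = n"
    and "length u + length v = n - 3"
    and "P = descent_polytope (u @ [Ly, Lx] @ v)"
    and "Q = descent_polytope (u @ [Ly, Ly] @ bar v)"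
  shows "(\<forall>i \<le> n - 1. coeff (f_polynomial P - f_polynomial Q) i > 0) \<and>
         (\<forall>i \<le> n - 1. card {F. F face_of P \<and> aff_dim F = int i}
                      > card {F. F face_of Q \<and> aff_dim F = int i})"
proof -
  have "f_polynomial P = face_poly (u @ [Ly, Lx] @ v)"
    "f_polynomial Q = face_poly (u @ [Ly, Ly] @ bar v)"
    unfolding assms(4,5) using assms(1-3)
    by (intro f_polynomial_descent_polytope; simp add: bar_def)+
  moreover have "length u + length v + 2 = n - 1"
    using assms(1,3) by simp
  ultimately have pos: "\<forall>i \<le> n - 1. coeff (f_polynomial P - f_polynomial Q) i > 0"
    using face_poly_difference_positive[of u v] by (simp add: positive_upto_def)
  moreover have "polytope P" "polytope Q"
    by (simp_all add: assms(4,5) polytope_descent_polytope)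
  ultimately show ?thesis by (simp add: coeff_f_polynomial)
qed

end
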